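(* Let $\omega_i=(\tau_{i2},\kappa_{i2})$, where $\tau_{i2}=Y_{i2}(1)-Y_{i2}(0)$ is the period-2 treatment effect and $\kappa_{i2}$ is the (random) period-2 cost of treatment. Suppose that $P(\nu_i>c)\in(0,1)$ for some $c\in\mathbb{R}$ and that $\nu_i$ is independent of $(\alpha_i,\varepsilon_{i1},\varepsilon_{i2},\mu_i,\eta_{i1},\eta_{i2})$. Suppose further that either $P(E[\dot Y_{i2}(0)-\dot Y_{i1}(0)\mid\omega_i]>0)<1$ or $P(E[\dot Y_{i2}(0)-\dot Y_{i1}(0)\mid\omega_i]<0)<1$. Then parallel trends, $E[Y_{i2}(0)-Y_{i1}(0)\mid G_i=1]=E[Y_{i2}(0)-Y_{i1}(0)\mid G_i=0]$, holds for all $g\in\mathcal{G}_\omega$ such that $G_i=g(\omega_i,\nu_i)$ satisfies $P(G_i=1)\in(0,1)$ if and only if $E[\dot Y_{i2}(0)-\dot Y_{i1}(0)\mid\tau_{i2},\kappa_{i2}]=0$ almost surely.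
   Context: Units are indexed by $i$ (i.i.d. across $i$; all statements are about a generic unit $i$) and periods by $t\in\{1,2\}$. The unobservables $\alpha_i,\varepsilon_{i1},\varepsilon_{i2}$ are finite-dimensional random vectors, $\mu_i,\eta_{i1},\eta_{i2}$ are additional random vectors, and $\nu_i$ is a scalar random variable. The untreated potential outcomes are real-valued and given by $Y_{it}(0)=\xi_t(\alpha_i,\varepsilon_{it})$, $t=1,2$, for arbitrary (measurable) functions $\xi_t$; $Y_{i2}(1)$ is the treated potential outcome in period 2. All relevant moments are assumed to exist (in particular $E|Y_{it}(0)|<\infty$). Notation: $\dot Y_{it}(0)=Y_{it}(0)-E[Y_{it}(0)]$. As for every choice of $\omega_i$ in this framework, $(\tau_{i2},\kappa_{i2})$ is a (measurable) function or subvector of $(\alpha_i,\varepsilon_{i1},\varepsilon_{i2},\mu_i,\eta_{i1},\eta_{i2})$ (the additional unobservables $\mu_i,\eta_{i1},\eta_{i2}$ may contain treatment effects and costs). Let $\mathcal{O}$ and $\mathcal{V}$ be the supports of $\omega_i$ and $\nu_i$; $\mathcal{G}_\omega$ is the class of all (measurable) functions $g:\mathcal{O}\times\mathcal{V}\to\{0,1\}$, called selection mechanisms, and the treatment-group indicator generated by $g$ is $G_i=g(\omega_i,\nu_i)$. The distribution of the unobservables is held fixed as $g$ varies. *)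

theory Defs
  imports "HOL-Probability.Probability"
begin

text \<open>Topological support of a random element: the points all of whose neighbourhoods
  carry positive probability.\<close>

definition rv_support :: "'w measure \<Rightarrow> ('w \<Rightarrow> 'b::topological_space) \<Rightarrow> 'b set" where
  "rv_support M X = {y. \<forall>U. open U \<and> y \<in> U \<longrightarrow> measure M {x \<in> space M. X x \<in> U} > 0}"

definition sigma_of :: "'w measure \<Rightarrow> ('w \<Rightarrow> 'b::topological_space) \<Rightarrow> 'w measure" where
  "sigma_of M X = vimage_algebra (space M) X borel"

text \<open>Independence of two random elements as independence of the sigma-algebras they
  generate; the library's \<open>indep_var\<close> requires both to have the same value type.\<close>

definition independent_of ::
  "'w measure \<Rightarrow> ('w \<Rightarrow> 'b::topological_space) \<Rightarrow> ('w \<Rightarrow> 'c::topological_space) \<Rightarrow> bool" where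
  "independent_of M X Z \<longleftrightarrow>
     prob_space.indep_set M (sets (sigma_of M X)) (sets (sigma_of M Z))"

definition centered :: "'w measure \<Rightarrow> ('w \<Rightarrow> real) \<Rightarrow> 'w \<Rightarrow> real" where
  "centered M Y = (\<lambda>x. Y x - integral\<^sup>L M Y)"

definition cond_mean :: "'w measure \<Rightarrow> ('w \<Rightarrow> real) \<Rightarrow> ('w \<Rightarrow> 'b::topological_space) \<Rightarrow> 'w \<Rightarrow> real" where
  "cond_mean M f X = real_cond_exp M (sigma_of M X) f"

text \<open>Elementary conditional expectation given an event of positive probability.\<close>

definition event_mean :: "'w measure \<Rightarrow> ('w \<Rightarrow> real) \<Rightarrow> 'w set \<Rightarrow> real" where
  "event_mean M f A = (LINT x:A|M. f x) / measure M A"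

text \<open>Measurable functions from \<open>S \<times> V\<close> to \<open>{0, 1}\<close>. As HOL functions are total, a function
  with domain \<open>S \<times> V\<close> is represented by its extension taking the fixed value \<open>undefined\<close>
  elsewhere. When \<open>S\<close> and \<open>V\<close> are the supports of random vectors \<open>\<omega>\<close> and \<open>\<nu>\<close>, the pair
  \<open>(\<omega>, \<nu>)\<close> leaves \<open>S \<times> V\<close> only on a measurable null event, so this value is immaterial.\<close>

definition selection_mechanisms ::
  "'b::topological_space set \<Rightarrow> 'c::topological_space set \<Rightarrow> ('b \<times> 'c \<Rightarrow> nat) set" where
  "selection_mechanisms S V =
     (restrict_space borel (S \<times> V) \<rightarrow>\<^sub>M count_space {0, 1}) \<inter> extensional (S \<times> V)"

definition parallel_trends ::
  "'w measure \<Rightarrow> ('w \<Rightarrow> real) \<Rightarrow> ('w \<Rightarrow> real) \<Rightarrow> ('w \<Rightarrow> nat) \<Rightarrow> bool" where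
  "parallel_trends M Y1 Y2 G \<longleftrightarrow>
     event_mean M (\<lambda>x. Y2 x - Y1 x) {x \<in> space M. G x = 1} =
     event_mean M (\<lambda>x. Y2 x - Y1 x) {x \<in> space M. G x = 0}"

end

theory Submission
  imports Defs
begin

text \<open>Write \<open>D\<close> for the centred change of the untreated outcome and \<open>m = E[D | \<omega>]\<close>. Since the
  two treatment groups exhaust the probability space up to a null set, parallel trends for \<open>G\<close>
  says exactly that \<open>D\<close> integrates to \<open>0\<close> over \<open>{G = 1}\<close>. If \<open>m = 0\<close>, Fubini's theorem for the
  product law of \<open>(U, \<nu>)\<close> gives this for every mechanism. Conversely, if \<open>m\<close> does not vanish,
  then, \<open>m\<close> having mean \<open>0\<close>, the event \<open>{m > 0}\<close> has probability strictly between \<open>0\<close> and \<open>1\<close>;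
  as it is an event \<open>{\<omega> \<in> B}\<close>, it is the treatment group of a mechanism ignoring \<open>\<nu>\<close>, and \<open>D\<close> has
  positive integral over it.\<close>

section \<open>Topological supports of random elements\<close>

lemma closed_rv_support: "closed (rv_support M X)"
proof -
  have "- rv_support M X = \<Union>{U. open U \<and> \<not> measure M {x \<in> space M. X x \<in> U} > 0}"
    unfolding rv_support_def by blast
  also have "open \<dots>"
    by (rule open_Union) blast
  finally show ?thesis
    by (simp add: closed_def)
qed

text \<open>A point outside the support has a null open neighbourhood, which can be shrunk to a null
  set of a countable basis. The union of these countably many null sets is still null.\<close>

lemma (in prob_space) AE_in_rv_support:
  fixes X :: "'a \<Rightarrow> 'b::second_countable_topology"
  assumes X [measurable]: "X \<in> borel_measurable M"
  shows "AE x in M. X x \<in> rv_support M X"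
proof -
  obtain \<B> :: "'b set set" where \<B>: "countable \<B>" "topological_basis \<B>"
    using ex_countable_basis by blast
  define \<N> where "\<N> = {W \<in> \<B>. prob {x \<in> space M. X x \<in> W} = 0}"
  have "countable \<N>"
    unfolding \<N>_def using \<B>(1) by simp
  moreover have "AE x in M. X x \<notin> W" if "W \<in> \<N>" for W
  proof -
    have [measurable]: "W \<in> sets borel"
      using that \<B>(2) by (auto simp: \<N>_def dest: topological_basis_open)
    have "{x \<in> space M. X x \<in> W} \<in> null_sets M"
      using that by (intro null_setsI) (auto simp: \<N>_def emeasure_eq_measure)
    then show ?thesis
      by (rule AE_I') auto
  qed
  ultimately have "AE x in M. \<forall>W\<in>\<N>. X x \<notin> W"
    by (simp add: AE_ball_countable)
  then show ?thesis
  proof (rule AE_mp, intro AE_I2 impI)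
    fix x assume x: "\<forall>W\<in>\<N>. X x \<notin> W"
    show "X x \<in> rv_support M X"
      unfolding rv_support_def
    proof (intro CollectI allI impI)
      fix U assume U: "open U \<and> X x \<in> U"
      then obtain W where W: "W \<in> \<B>" "X x \<in> W" "W \<subseteq> U"
        using \<B>(2) by (auto elim: topological_basisE)
      have [measurable]: "U \<in> sets borel"
        using U by simp
      have "0 < prob {x \<in> space M. X x \<in> W}"
        using x W by (auto simp: \<N>_def zero_less_measure_iff)
      also have "\<dots> \<le> prob {x \<in> space M. X x \<in> U}"
        using W(3) by (intro finite_measure_mono) auto
      finally show "0 < prob {x \<in> space M. X x \<in> U}" .
    qed
  qed
qed

section \<open>Generated sigma-algebras, product laws and conditional means\<close>

lemma sets_sigma_of: "sets (sigma_of M X) = {X -` A \<inter> space M | A. A \<in> sets borel}"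
  unfolding sigma_of_def by (rule sets_vimage_algebra2) simp

lemma space_sigma_of [simp]: "space (sigma_of M X) = space M"
  by (simp add: sigma_of_def)

lemma subalgebra_sigma_of:
  assumes "X \<in> borel_measurable M"
  shows "subalgebra M (sigma_of M X)"
  using assms by (auto simp: subalgebra_def sets_sigma_of)

lemma (in prob_space) sigma_finite_subalgebra_sigma_of:
  assumes "X \<in> borel_measurable M"
  shows "sigma_finite_subalgebra M (sigma_of M X)"
  by (intro finite_measure_subalgebra_is_sigma_finite finite_measure_subalgebra.intro
      finite_measure_subalgebra_axioms.intro subalgebra_sigma_of assms)
    (rule finite_measure_axioms)

text \<open>Independence of the generated sigma-algebras factorises the joint law on Borel
  rectangles, and a product of sigma-finite measures is determined by its values there.\<close>

lemma (in prob_space) distr_Pair_independent_of: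
  fixes X :: "'a \<Rightarrow> 'b::second_countable_topology" and Z :: "'a \<Rightarrow> 'c::second_countable_topology"
  assumes [measurable]: "X \<in> borel_measurable M" "Z \<in> borel_measurable M"
    and indep: "independent_of M Z X"
  shows "distr M borel X \<Otimes>\<^sub>M distr M borel Z = distr M borel (\<lambda>x. (X x, Z x))"
proof (rule pair_measure_eqI)
  show "sigma_finite_measure (distr M borel X)" "sigma_finite_measure (distr M borel Z)"
    by (auto intro!: prob_space_imp_sigma_finite prob_space_distr)
  \<comment> \<open>In second-countable spaces the product of the Borel sigma-algebras is the Borel
    sigma-algebra of the product space, so both measures have the same sets.\<close>
  have "sets (distr M borel X \<Otimes>\<^sub>M distr M borel Z) = sets (borel \<Otimes>\<^sub>M borel)"
    by (rule sets_pair_measure_cong) simp_all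
  then show "sets (distr M borel X \<Otimes>\<^sub>M distr M borel Z) = sets (distr M borel (\<lambda>x. (X x, Z x)))"
    by (simp only: borel_prod sets_distr)
next
  fix A B assume "A \<in> sets (distr M borel X)" "B \<in> sets (distr M borel Z)"
  then have [measurable]: "A \<in> sets borel" "B \<in> sets borel"
    by auto
  have [measurable]: "A \<times> B \<in> sets borel"
    unfolding borel_prod[symmetric] by simp
  have "prob ((Z -` B \<inter> space M) \<inter> (X -` A \<inter> space M)) =
      prob (Z -` B \<inter> space M) * prob (X -` A \<inter> space M)"
    by (rule indep_setD[OF indep[unfolded independent_of_def]]) (auto simp: sets_sigma_of)
  moreover have "(\<lambda>x. (X x, Z x)) -` (A \<times> B) \<inter> space M =
      (Z -` B \<inter> space M) \<inter> (X -` A \<inter> space M)"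
    by auto
  ultimately show "emeasure (distr M borel X) A * emeasure (distr M borel Z) B =
      emeasure (distr M borel (\<lambda>x. (X x, Z x))) (A \<times> B)"
    by (simp add: emeasure_distr emeasure_eq_measure ennreal_mult'' mult.commute)
qed

text \<open>With \<open>\<nu>\<close> frozen at a value \<open>v\<close>, the event becomes one in
  the sigma-algebra of \<open>\<omega>\<close>, over which \<open>d (U x)\<close> has the same
  integral as its conditional mean, namely 0. Freezing is legitimate because
  \<open>(U, \<nu>)\<close> has a product law and \<open>\<omega>\<close> is a function of
  \<open>U\<close>.\<close>

lemma (in prob_space) set_integral_eq_0_of_cond_mean_0:
  fixes U :: "'a \<Rightarrow> 'b::second_countable_topology" and \<nu> :: "'a \<Rightarrow> 'c::second_countable_topology"
    and \<omega> :: "'a \<Rightarrow> 'd::second_countable_topology" and d :: "'b \<Rightarrow> real"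
  assumes [measurable]: "U \<in> borel_measurable M" "\<nu> \<in> borel_measurable M"
      "\<omega> \<in> borel_measurable M" "h \<in> borel_measurable borel" "d \<in> borel_measurable borel"
      "C \<in> sets borel"
    and indep: "independent_of M \<nu> U"
    and \<omega>: "\<And>x. x \<in> space M \<Longrightarrow> \<omega> x = h (U x)"
    and int: "integrable M (\<lambda>x. d (U x))"
    and ce: "AE x in M. cond_mean M (\<lambda>x. d (U x)) \<omega> x = 0"
  shows "(LINT x:{x \<in> space M. (\<omega> x, \<nu> x) \<in> C}|M. d (U x)) = 0"
proof -
  let ?PU = "distr M borel U" and ?PN = "distr M borel \<nu>"
  interpret PU: prob_space ?PU by (rule prob_space_distr) simp
  interpret PN: prob_space ?PN by (rule prob_space_distr) simp
  interpret P: pair_sigma_finite ?PU ?PN ..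
  interpret S: sigma_finite_subalgebra M "sigma_of M \<omega>"
    by (rule sigma_finite_subalgebra_sigma_of) simp
  \<comment> \<open>The integrand, moved to the value space of \<open>(U, \<nu>)\<close> with
    \<open>h u\<close> in place of \<open>\<omega>\<close>.\<close>
  define f where "f = (\<lambda>u v. indicator C (h u, v) * d u)"
  have law: "?PU \<Otimes>\<^sub>M ?PN = distr M borel (\<lambda>x. (U x, \<nu> x))"
    by (rule distr_Pair_independent_of) (use indep in auto)
  have "(\<lambda>p. indicator C (h (fst p), snd p) * d (fst p)) \<in> borel_measurable (borel \<Otimes>\<^sub>M borel)"
    by measurable
  then have f_meas [measurable]: "case_prod f \<in> borel_measurable borel"
    by (simp add: f_def borel_prod split_beta')
  have int_f: "integrable M (\<lambda>x. f (U x) (\<nu> x))"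
    unfolding f_def by (rule Bochner_Integration.integrable_bound[OF int]) (auto simp: indicator_def)
  then have "integrable (?PU \<Otimes>\<^sub>M ?PN) (case_prod f)"
    by (simp add: law integrable_distr_eq)
  \<comment> \<open>The inner integral runs over \<open>u\<close> and the outer one over
    \<open>v\<close>, so each slice fixes a value of \<open>\<nu>\<close>.\<close>
  note fubini = P.integral_snd[OF this]
  have slice: "(\<integral>u. f u v \<partial>?PU) = 0" for v
  proof -
    have Cv [measurable]: "{w. (w, v) \<in> C} \<in> sets borel"
      by measurable
    define A where "A = \<omega> -` {w. (w, v) \<in> C} \<inter> space M"
    have A: "A \<in> sets (sigma_of M \<omega>)"
      unfolding sets_sigma_of A_def using Cv by blast
    have "(\<integral>u. f u v \<partial>?PU) = (\<integral>x. f (U x) v \<partial>M)"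
      by (rule integral_distr) (auto simp: f_def)
    also have "\<dots> = (LINT x:A|M. d (U x))"
      unfolding set_lebesgue_integral_def
      by (rule Bochner_Integration.integral_cong) (auto simp: f_def A_def \<omega> indicator_def)
    also have "\<dots> = (LINT x:A|M. cond_mean M (\<lambda>x. d (U x)) \<omega> x)"
      unfolding cond_mean_def by (rule S.real_cond_exp_intA[OF int A])
    also have "\<dots> = 0"
      unfolding set_lebesgue_integral_def
      by (rule integral_eq_zero_AE) (use ce in auto)
    finally show ?thesis .
  qed
  have "(LINT x:{x \<in> space M. (\<omega> x, \<nu> x) \<in> C}|M. d (U x)) = (\<integral>x. f (U x) (\<nu> x) \<partial>M)"
    unfolding set_lebesgue_integral_def
    by (rule Bochner_Integration.integral_cong) (auto simp: f_def \<omega> indicator_def)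
  also have "\<dots> = integral\<^sup>L (?PU \<Otimes>\<^sub>M ?PN) (case_prod f)"
    by (simp add: law integral_distr)
  also have "\<dots> = 0"
    unfolding fubini[symmetric] by (simp add: slice)
  finally show ?thesis .
qed

text \<open>Write \<open>p\<close> for the probability of \<open>A\<close>, \<open>a\<close> for the
  integral of \<open>f\<close> over \<open>A\<close> and \<open>e\<close> for its expectation. As
  \<open>B\<close> is the complement of \<open>A\<close> up to a null set, the two means are
  \<open>a / p\<close> and \<open>(e - a) / (1 - p)\<close>. Clearing the nonzero denominators turns
  their equality into \<open>a = p * e\<close>.\<close>

lemma (in prob_space) event_mean_eq_iff:
  assumes f: "integrable M f" and [measurable]: "A \<in> events" "B \<in> events"
    and "A \<inter> B = {}" "AE x in M. x \<in> A \<union> B" "prob A \<in> {0<..<1}"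
  shows "event_mean M f A = event_mean M f B \<longleftrightarrow> (LINT x:A|M. centered M f x) = 0"
proof -
  have si: "set_integrable M E f" if "E \<in> events" for E
    unfolding set_integrable_def using that f by (rule integrable_mult_indicator)
  have "prob A + prob B = prob (A \<union> B)"
    using assms by (simp add: finite_measure_Union)
  also have "\<dots> = 1"
    using assms by (intro prob_eq_1[THEN iffD2]) auto
  finally have B: "prob B = 1 - prob A"
    by simp
  have "(LINT x:A|M. f x) + (LINT x:B|M. f x) = (LINT x:A \<union> B|M. f x)"
    using assms by (intro set_integral_Un[symmetric] si) auto
  also have "\<dots> = expectation f"
    unfolding set_lebesgue_integral_def
    by (intro integral_cong_AE) (use assms in auto)
  finally have sum: "(LINT x:B|M. f x) = expectation f - (LINT x:A|M. f x)"
    by simp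
  have "(LINT x:A|M. centered M f x) = (LINT x:A|M. f x) - (LINT x:A|M. expectation f)"
    unfolding centered_def
    by (intro set_integral_diff si) (use assms(2) in \<open>simp_all add: set_integrable_def emeasure_eq_measure integrable_real_indicator\<close>)
  also have "(LINT x:A|M. expectation f) = prob A * expectation f"
    by (simp add: set_lebesgue_integral_def)
  finally show ?thesis
    using assms(6) unfolding event_mean_def B sum
    by (auto simp: field_simps)
qed

text \<open>A mean-zero function of one sign vanishes almost surely. A conditional mean that does
  not vanish therefore takes both signs with positive probability, and the set where it is positive
  serves as the event.\<close>

lemma (in prob_space) cond_mean_expectation_0_dichotomy:
  assumes f: "integrable M f" "expectation f = 0" and X: "X \<in> borel_measurable M"
    and nz: "\<not> (AE x in M. cond_mean M f X x = 0)"
  obtains B where "B \<in> sets borel" "prob {x \<in> space M. X x \<in> B} \<in> {0<..<1}"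
    "(LINT x:{x \<in> space M. X x \<in> B}|M. f x) \<noteq> 0"
proof -
  interpret S: sigma_finite_subalgebra M "sigma_of M X"
    by (rule sigma_finite_subalgebra_sigma_of) fact
  define m where "m = cond_mean M f X"
  have m_sub: "m \<in> borel_measurable (sigma_of M X)"
    unfolding m_def cond_mean_def by simp
  have int_m: "integrable M m" and mean_m: "expectation m = 0"
    unfolding m_def cond_mean_def using f S.real_cond_exp_int by auto
  have [measurable]: "m \<in> borel_measurable M"
    using int_m by simp
  \<comment> \<open>The factor \<open>s\<close> covers both signs: it is -1 when
    \<open>{m > 0}\<close> is assumed null, and 1 when it is assumed to have probability
    one.\<close>
  have zero_if_sign: "AE x in M. m x = 0" if "AE x in M. 0 \<le> s * m x" "s \<noteq> 0" for s
  proof -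
    have "AE x in M. s * m x = 0"
      using integral_nonneg_eq_0_iff_AE[of M "\<lambda>x. s * m x"] int_m mean_m that by simp
    then show ?thesis
      using that by simp
  qed
  define A where "A = {x \<in> space M. m x > 0}"
  \<comment> \<open>Measurability of \<open>m\<close> with respect to the sigma-algebra of
    \<open>X\<close> is what turns \<open>A\<close> into a preimage under \<open>X\<close> and so
    yields \<open>B\<close>.\<close>
  have A_sub: "A \<in> sets (sigma_of M X)"
    using measurable_sets[OF m_sub, of "{0<..}"] by (simp add: A_def vimage_def Int_def conj_commute)
  then obtain B where B: "B \<in> sets borel" "A = X -` B \<inter> space M"
    by (auto simp: sets_sigma_of)
  have A_eq: "{x \<in> space M. X x \<in> B} = A"
    using B by auto
  have [measurable]: "A \<in> events"
    by (simp add: A_def)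
  have "prob A \<noteq> 0"
  proof
    assume "prob A = 0"
    then have "AE x in M. x \<notin> A"
      by (simp add: prob_eq_0)
    then have "AE x in M. 0 \<le> -1 * m x"
      by (rule AE_mp) (auto simp: A_def)
    from zero_if_sign[OF this] nz show False
      by (simp add: m_def)
  qed
  moreover have "prob A \<noteq> 1"
  proof
    assume "prob A = 1"
    then have "AE x in M. x \<in> A"
      by (simp add: prob_eq_1)
    then have "AE x in M. 0 \<le> 1 * m x"
      by (rule AE_mp) (auto simp: A_def)
    from zero_if_sign[OF this] nz show False
      by (simp add: m_def)
  qed
  ultimately have "prob A \<in> {0<..<1}"
    using prob_le_1[of A] by (auto simp: zero_less_measure_iff less_le)
  \<comment> \<open>Over \<open>A\<close> the integrals of \<open>f\<close> and \<open>m\<close>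
    agree, and \<open>m\<close> is strictly positive there, so a zero integral would make
    \<open>A\<close> null.\<close>
  moreover have "(LINT x:A|M. f x) \<noteq> 0"
  proof
    assume "(LINT x:A|M. f x) = 0"
    then have "(LINT x:A|M. m x) = 0"
      using S.real_cond_exp_intA[OF f(1) A_sub] by (simp add: m_def cond_mean_def)
    moreover have "integrable M (\<lambda>x. indicator A x *\<^sub>R m x)"
      by (rule integrable_mult_indicator) (use int_m in auto)
    ultimately have "AE x in M. indicator A x *\<^sub>R m x = 0"
      unfolding set_lebesgue_integral_def
      by (subst (asm) integral_nonneg_eq_0_iff_AE) (auto simp: A_def indicator_def)
    then have "AE x in M. x \<notin> A"
      by (rule AE_mp) (auto simp: A_def indicator_def)
    then show False
      using \<open>prob A \<noteq> 0\<close> by (simp add: prob_eq_0)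
  qed
  ultimately show ?thesis
    using that[of B] B(1) A_eq by simp
qed

section \<open>Borel measurability of selection mechanisms and the equivalence\<close>

lemma selection_mechanism_level_set:
  assumes "g \<in> selection_mechanisms S V" "closed S" "closed V" "k \<in> {0, 1}"
  shows "{p \<in> S \<times> V. g p = k} \<in> sets borel"
proof -
  \<comment> \<open>A mechanism is measurable only for the trace sigma-algebra on its domain. Since
    the domain is closed, hence Borel, trace sets are Borel in the whole product space.\<close>
  have SV: "S \<times> V \<in> sets borel"
    using assms by (intro borel_closed closed_Times)
  have "g -` {k} \<inter> space (restrict_space borel (S \<times> V)) \<in> sets (restrict_space borel (S \<times> V))"
    using assms by (intro measurable_sets[of g _ "count_space {0, 1}"])
      (auto simp: selection_mechanisms_def)
  then show ?thesis
    using SV by (simp add: sets_restrict_space_iff space_restrict_space vimage_def Int_def conj_commute)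
qed

text \<open>Supplies the mechanism for the converse direction, where treatment is decided by the
  first argument alone.\<close>

lemma selection_mechanism_indicator:
  assumes "B \<in> sets borel"
  shows "(\<lambda>p\<in>S \<times> V. if fst p \<in> B then 1 else 0) \<in> selection_mechanisms S V"
proof -
  have [measurable]: "fst \<in> borel \<rightarrow>\<^sub>M borel"
    by (intro borel_measurable_continuous_onI continuous_intros)
  have "(\<lambda>p. if fst p \<in> B then 1 else 0) \<in> borel \<rightarrow>\<^sub>M count_space {0, 1::nat}"
    using assms by measurable
  then have "(\<lambda>p. if fst p \<in> B then 1 else 0)
      \<in> restrict_space borel (S \<times> V) \<rightarrow>\<^sub>M count_space {0, 1::nat}"
    by (rule measurable_restrict_space1)
  then have "(\<lambda>p\<in>S \<times> V. if fst p \<in> B then 1 else 0)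
      \<in> restrict_space borel (S \<times> V) \<rightarrow>\<^sub>M count_space {0, 1::nat}"
    by (rule measurable_cong[THEN iffD1, rotated]) (simp add: space_restrict_space)
  then show ?thesis
    by (simp add: selection_mechanisms_def)
qed

theorem corollary3p5:
  fixes M :: "'w measure"
    and \<alpha> :: "'w \<Rightarrow> 'a::euclidean_space"
    and \<epsilon>1 :: "'w \<Rightarrow> 'e1::euclidean_space"
    and \<epsilon>2 :: "'w \<Rightarrow> 'e2::euclidean_space"
    and \<mu> :: "'w \<Rightarrow> 'm::euclidean_space"
    and \<eta>1 :: "'w \<Rightarrow> 'h1::euclidean_space"
    and \<eta>2 :: "'w \<Rightarrow> 'h2::euclidean_space"
    and \<nu> :: "'w \<Rightarrow> real"
    and \<xi>1 :: "'a \<times> 'e1 \<Rightarrow> real"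
    and \<xi>2 :: "'a \<times> 'e2 \<Rightarrow> real"
    and Y10 Y20 Y21 :: "'w \<Rightarrow> real"
    and \<tau> \<kappa> :: "'w \<Rightarrow> real"
    and U :: "'w \<Rightarrow> 'a \<times> 'e1 \<times> 'e2 \<times> 'm \<times> 'h1 \<times> 'h2"
    and \<omega> :: "'w \<Rightarrow> real \<times> real"
    and h :: "'a \<times> 'e1 \<times> 'e2 \<times> 'm \<times> 'h1 \<times> 'h2 \<Rightarrow> real \<times> real"
    and c :: real
  assumes "prob_space M"
    and "\<alpha> \<in> borel_measurable M" and "\<epsilon>1 \<in> borel_measurable M" and "\<epsilon>2 \<in> borel_measurable M"
    and "\<mu> \<in> borel_measurable M" and "\<eta>1 \<in> borel_measurable M" and "\<eta>2 \<in> borel_measurable M"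
    and "\<nu> \<in> borel_measurable M"
    and "\<xi>1 \<in> borel_measurable borel" and "\<xi>2 \<in> borel_measurable borel"
    and "Y10 = (\<lambda>x. \<xi>1 (\<alpha> x, \<epsilon>1 x))" and "Y20 = (\<lambda>x. \<xi>2 (\<alpha> x, \<epsilon>2 x))"
    and "Y21 \<in> borel_measurable M"
    and "integrable M Y10" and "integrable M Y20"
    and "\<tau> = (\<lambda>x. Y21 x - Y20 x)" and "\<kappa> \<in> borel_measurable M"
    and "\<omega> = (\<lambda>x. (\<tau> x, \<kappa> x))"
    and "U = (\<lambda>x. (\<alpha> x, \<epsilon>1 x, \<epsilon>2 x, \<mu> x, \<eta>1 x, \<eta>2 x))"
    and "h \<in> borel_measurable borel" and "\<And>x. x \<in> space M \<Longrightarrow> \<omega> x = h (U x)"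
    and "measure M {x \<in> space M. \<nu> x > c} \<in> {0<..<1}"
    and "independent_of M \<nu> U"
    and "measure M {x \<in> space M.
           cond_mean M (\<lambda>x. centered M Y20 x - centered M Y10 x) \<omega> x > 0} < 1 \<or>
         measure M {x \<in> space M.
           cond_mean M (\<lambda>x. centered M Y20 x - centered M Y10 x) \<omega> x < 0} < 1"
  shows "(\<forall>g \<in> selection_mechanisms (rv_support M \<omega>) (rv_support M \<nu>).
            measure M {x \<in> space M. g (\<omega> x, \<nu> x) = 1} \<in> {0<..<1} \<longrightarrow>
            parallel_trends M Y10 Y20 (\<lambda>x. g (\<omega> x, \<nu> x)))
         \<longleftrightarrow> (AE x in M.
            cond_mean M (\<lambda>x. centered M Y20 x - centered M Y10 x) (\<lambda>x. (\<tau> x, \<kappa> x)) x = 0)"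
proof -
  note \<omega>_def = \<open>\<omega> = (\<lambda>x. (\<tau> x, \<kappa> x))\<close> and U_def = \<open>U = (\<lambda>x. (\<alpha> x, \<epsilon>1 x, \<epsilon>2 x, \<mu> x, \<eta>1 x, \<eta>2 x))\<close>
    and Y10_def = \<open>Y10 = (\<lambda>x. \<xi>1 (\<alpha> x, \<epsilon>1 x))\<close> and Y20_def = \<open>Y20 = (\<lambda>x. \<xi>2 (\<alpha> x, \<epsilon>2 x))\<close>
    and Y_int [simp] = \<open>integrable M Y10\<close> \<open>integrable M Y20\<close>
  note [measurable] = assms(2-10,13,17,20)
  interpret prob_space M by fact
  let ?S = "rv_support M \<omega>" and ?V = "rv_support M \<nu>"
  define f where "f = (\<lambda>x. Y20 x - Y10 x)"
  define D where "D = centered M f"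
  \<comment> \<open>\<open>D\<close> as a function of the values of \<open>U\<close>;
    \<open>r\<close> bundles the components for \<open>\<mu>\<close>, \<open>\<eta>1\<close> and
    \<open>\<eta>2\<close>.\<close>
  define d where "d = (\<lambda>(a, e1, e2, r :: 'm \<times> 'h1 \<times> 'h2). \<xi>2 (a, e2) - \<xi>1 (a, e1) - expectation f)"
  have f_int [simp]: "integrable M f"
    by (simp add: f_def)
  have D_eq: "(\<lambda>x. centered M Y20 x - centered M Y10 x) = D"
    by (auto simp: D_def f_def centered_def)
  have D_int [simp]: "integrable M D" and D_mean: "expectation D = 0"
    by (simp_all add: D_def centered_def prob_space)
  have [measurable]: "D \<in> borel_measurable M"
    using D_int by (rule borel_measurable_integrable)
  have D_d: "D = (\<lambda>x. d (U x))"
    by (simp add: D_def f_def d_def centered_def U_def Y10_def Y20_def)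
  have d_meas: "d \<in> borel_measurable borel"
    unfolding d_def borel_prod[symmetric] split_beta
    by (measurable; simp add: borel_prod)
  have [measurable]: "Y20 \<in> borel_measurable M"
    using Y_int(2) by (rule borel_measurable_integrable)
  have \<omega>_meas [measurable]: "\<omega> \<in> borel_measurable M"
    unfolding \<omega>_def \<open>\<tau> = (\<lambda>x. Y21 x - Y20 x)\<close> by measurable
  have U_meas: "U \<in> borel_measurable M"
    unfolding U_def by measurable
  have supp: "AE x in M. \<omega> x \<in> ?S \<and> \<nu> x \<in> ?V"
    using AE_in_rv_support[OF \<omega>_meas] AE_in_rv_support[OF \<open>\<nu> \<in> borel_measurable M\<close>] by auto
  define C where "C = (\<lambda>g k. {p \<in> ?S \<times> ?V. g p = (k::nat)})"
  have C_meas: "C g k \<in> sets borel" if "g \<in> selection_mechanisms ?S ?V" "k \<in> {0, 1}" for g k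
    unfolding C_def using that by (intro selection_mechanism_level_set closed_rv_support)
  have SV [measurable]: "?S \<times> ?V \<in> sets borel"
    by (intro borel_closed closed_Times closed_rv_support)
  have g_meas: "{x \<in> space M. g (\<omega> x, \<nu> x) = k} \<in> events"
    if g: "g \<in> selection_mechanisms ?S ?V" and k: "k \<in> {0, 1}" for g k
  proof -
    have [measurable]: "C g k \<in> sets borel"
      using g k by (rule C_meas)
    have arb: "g p = undefined" if "p \<notin> ?S \<times> ?V" for p
      using g that unfolding selection_mechanisms_def by (blast intro: extensional_arb)
    \<comment> \<open>Off the domain \<open>g\<close> is the constant \<open>undefined\<close>, so
      \<open>undefined = k\<close> has a fixed truth value. The event thus consists of the preimage
      of \<open>C g k\<close> together with either all or none of the preimage of the complement of
      the domain.\<close>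
    have "g (\<omega> x, \<nu> x) = k \<longleftrightarrow> (\<omega> x, \<nu> x) \<in> C g k \<or>
        ((\<omega> x, \<nu> x) \<notin> ?S \<times> ?V \<and> undefined = k)" for x
      using arb[of "(\<omega> x, \<nu> x)"] by (cases "(\<omega> x, \<nu> x) \<in> ?S \<times> ?V") (auto simp: C_def)
    then have "{x \<in> space M. g (\<omega> x, \<nu> x) = k} = {x \<in> space M. (\<omega> x, \<nu> x) \<in> C g k \<or>
        ((\<omega> x, \<nu> x) \<notin> ?S \<times> ?V \<and> undefined = k)}"
      by simp
    also have "\<dots> \<in> events"
      by measurable
    finally show ?thesis .
  qed
  have pt_iff: "parallel_trends M Y10 Y20 (\<lambda>x. g (\<omega> x, \<nu> x)) \<longleftrightarrow>
      (LINT x:{x \<in> space M. g (\<omega> x, \<nu> x) = 1}|M. D x) = 0"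
    if g: "g \<in> selection_mechanisms ?S ?V"
      and p: "prob {x \<in> space M. g (\<omega> x, \<nu> x) = 1} \<in> {0<..<1}" for g
  proof -
    have bin: "g (w, v) \<in> {0, 1}" if "w \<in> ?S" "v \<in> ?V" for w v
      using g that by (auto simp: selection_mechanisms_def space_restrict_space
          dest!: measurable_space[where x = "(w, v)"])
    \<comment> \<open>The pair \<open>(\<omega>, \<nu>)\<close> almost surely lies in the product of
      the supports, where \<open>g\<close> is 0 or 1.\<close>
    have "AE x in M. x \<in> {x \<in> space M. g (\<omega> x, \<nu> x) = 1} \<union> {x \<in> space M. g (\<omega> x, \<nu> x) = 0}"
      using supp AE_space 
      by eventually_elim (use bin in \<open>fastforce simp del: split_paired_All\<close>)
    then show ?thesis
      unfolding parallel_trends_def D_def f_def[symmetric]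
      using p by (intro event_mean_eq_iff g_meas g) auto
  qed
  have "(\<forall>g \<in> selection_mechanisms ?S ?V. prob {x \<in> space M. g (\<omega> x, \<nu> x) = 1} \<in> {0<..<1} \<longrightarrow>
      parallel_trends M Y10 Y20 (\<lambda>x. g (\<omega> x, \<nu> x))) \<longleftrightarrow> (AE x in M. cond_mean M D \<omega> x = 0)"
    (is "?PT \<longleftrightarrow> ?CM")
  proof
    assume CM: ?CM
    show ?PT
    proof (intro ballI impI)
      fix g assume g: "g \<in> selection_mechanisms ?S ?V"
        and p: "prob {x \<in> space M. g (\<omega> x, \<nu> x) = 1} \<in> {0<..<1}"
      have C1 [measurable]: "C g 1 \<in> sets borel"
        using g by (intro C_meas) auto
      have [measurable]: "{x \<in> space M. g (\<omega> x, \<nu> x) = 1} \<in> events"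
        using g by (intro g_meas) auto
      \<comment> \<open>Passing to the Borel set \<open>C g 1\<close> alters the event only where
        the pair leaves the supports, which is null whatever value \<open>undefined\<close>
        has.\<close>
      have "(LINT x:{x \<in> space M. g (\<omega> x, \<nu> x) = 1}|M. D x) =
          (LINT x:{x \<in> space M. (\<omega> x, \<nu> x) \<in> C g 1}|M. D x)"
      proof (rule set_integral_cong_set)
        show "AE x in M. x \<in> {x \<in> space M. (\<omega> x, \<nu> x) \<in> C g 1} \<longleftrightarrow>
            x \<in> {x \<in> space M. g (\<omega> x, \<nu> x) = 1}"
          using supp by eventually_elim (simp add: C_def)
      qed (simp_all add: set_borel_measurable_def del: One_nat_def)
      also have "\<dots> = 0"
        unfolding D_d
        using assms(8,20-21,23) U_meas d_meas C1 CM D_int \<omega>_meas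
        by (intro set_integral_eq_0_of_cond_mean_0[where h = h]) (simp_all add: D_d)
      finally show "parallel_trends M Y10 Y20 (\<lambda>x. g (\<omega> x, \<nu> x))"
        using pt_iff[OF g p] by simp
    qed
  next
    assume PT: ?PT
    show ?CM
    proof (rule ccontr)
      assume "\<not> ?CM"
      then obtain B where B [measurable]: "B \<in> sets borel"
        and p: "prob {x \<in> space M. \<omega> x \<in> B} \<in> {0<..<1}"
        and nz: "(LINT x:{x \<in> space M. \<omega> x \<in> B}|M. D x) \<noteq> 0"
        by (rule cond_mean_expectation_0_dichotomy[OF D_int D_mean \<omega>_meas])
      \<comment> \<open>This mechanism treats the units with \<open>\<omega>\<close> in
        \<open>B\<close>. Off the supports it is \<open>undefined\<close>, so its treatment group
        agrees with that event only almost surely.\<close>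
      define g where "g = (\<lambda>p\<in>?S \<times> ?V. if fst p \<in> B then 1 else 0 :: nat)"
      have g: "g \<in> selection_mechanisms ?S ?V"
        unfolding g_def by (rule selection_mechanism_indicator) fact
      have [measurable]: "{x \<in> space M. g (\<omega> x, \<nu> x) = 1} \<in> events"
        using g by (intro g_meas) auto
      have ae: "AE x in M. x \<in> {x \<in> space M. g (\<omega> x, \<nu> x) = 1} \<longleftrightarrow> x \<in> {x \<in> space M. \<omega> x \<in> B}"
        using supp by eventually_elim (auto simp: g_def)
      have "prob {x \<in> space M. g (\<omega> x, \<nu> x) = 1} = prob {x \<in> space M. \<omega> x \<in> B}"
        by (rule finite_measure_eq_AE[OF ae]) measurable
      moreover have "(LINT x:{x \<in> space M. g (\<omega> x, \<nu> x) = 1}|M. D x) =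
          (LINT x:{x \<in> space M. \<omega> x \<in> B}|M. D x)"
        by (rule set_integral_cong_set[OF _ _ ae, symmetric]) (simp_all add: set_borel_measurable_def del: One_nat_def)
      ultimately show False
        using PT g p nz pt_iff[OF g] by simp
    qed
  qed
  then show ?thesis
    unfolding D_eq \<omega>_def .
qed

end
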